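(* The variety of Łukasiewicz near semirings is congruence regular, with witness terms $$t_1(x,y,z)=\big((x\cdot\alpha(y))+(y\cdot\alpha(x))\big)+z,\qquad t_2(x,y,z)=\alpha\big((x\cdot\alpha(y))+(y\cdot\alpha(x))\big)\cdot z.$$ That is, in every Łukasiewicz near semiring and for all elements $x,y,z$ one has $t_1(x,y,z)=t_2(x,y,z)=z$ if and only if $x=y$; and every Łukasiewicz near semiring is congruence regular.
   Context: A near semiring is an algebra $\langle R,+,\cdot,0,1\rangle$ such that: (i) $\langle R,+,0\rangle$ is a commutative monoid; (ii) $x\cdot 1=x=1\cdot x$ (multiplication need not be associative or commutative); (iii) $(x+y)\cdot z=(x\cdot z)+(y\cdot z)$; (iv) $x\cdot 0=0\cdot x=0$. It is idempotent if $x+x=x$; then $x\le y$ iff $x+y=y$ defines a partial order, called the induced order. An involutive near semiring is an idempotent near semiring with a map $\alpha:R\to R$ such that $\alpha(\alpha(x))=x$, and $x\le y$ implies $\alpha(y)\le\alpha(x)$. A Łukasiewicz near semiring is an involutive near semiring satisfying the identity $\alpha(x\cdot\alpha(y))\cdot\alpha(y)=\alpha(y\cdot\alpha(x))\cdot\alpha(x)$. An algebra $\mathbf{A}$ is congruence regular if for all congruences $\theta,\phi$ of $\mathbf{A}$ and every $a\in A$, $[a]_\theta=[a]_\phi$ implies $\theta=\phi$. A variety is congruence regular if all its members are. By a theorem of Csákány, a variety is congruence regular iff there are ternary terms $t_i(x,y,z)$, $i\ge 1$, such that in its members $t_i(x,y,z)=z$ for all $i$ holds if and only if $x=y$; such terms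 are called witness terms. Congruences are with respect to all operations $+,\cdot,\alpha,0,1$. *)

theory Defs
  imports "HOL-Algebra.Ring"
begin

text \<open>Unlike in \<^locale>\<open>monoid\<close>, multiplication need not be associative.\<close>

locale near_semiring = abelian_monoid R for R (structure) +
  assumes m_closed: "\<lbrakk>x \<in> carrier R; y \<in> carrier R\<rbrakk> \<Longrightarrow> x \<otimes> y \<in> carrier R"
    and one_closed: "\<one> \<in> carrier R"
    and r_one: "x \<in> carrier R \<Longrightarrow> x \<otimes> \<one> = x"
    and l_one: "x \<in> carrier R \<Longrightarrow> \<one> \<otimes> x = x"
    and l_distr: "\<lbrakk>x \<in> carrier R; y \<in> carrier R; z \<in> carrier R\<rbrakk>
      \<Longrightarrow> (x \<oplus> y) \<otimes> z = (x \<otimes> z) \<oplus> (y \<otimes> z)"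
    and r_null: "x \<in> carrier R \<Longrightarrow> x \<otimes> \<zero> = \<zero>"
    and l_null: "x \<in> carrier R \<Longrightarrow> \<zero> \<otimes> x = \<zero>"

locale idempotent_near_semiring = near_semiring +
  assumes add_idem: "x \<in> carrier R \<Longrightarrow> x \<oplus> x = x"

definition induced_le :: "('a, 'm) ring_scheme \<Rightarrow> 'a \<Rightarrow> 'a \<Rightarrow> bool" (infix \<open>\<preceq>\<index>\<close> 50)
  where "x \<preceq>\<^bsub>R\<^esub> y \<longleftrightarrow> x \<oplus>\<^bsub>R\<^esub> y = y"

record 'a involutive_ring = "'a ring" +
  invol :: "'a \<Rightarrow> 'a" (\<open>\<alpha>\<index>\<close>)

locale involutive_near_semiring = idempotent_near_semiring R
  for R :: "('a, 'm) involutive_ring_scheme" (structure) +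
  assumes invol_closed: "x \<in> carrier R \<Longrightarrow> \<alpha> x \<in> carrier R"
    and invol_invol: "x \<in> carrier R \<Longrightarrow> \<alpha> (\<alpha> x) = x"
    and invol_antimono: "\<lbrakk>x \<in> carrier R; y \<in> carrier R; x \<preceq> y\<rbrakk> \<Longrightarrow> \<alpha> y \<preceq> \<alpha> x"

locale lukasiewicz_near_semiring = involutive_near_semiring +
  assumes lukasiewicz: "\<lbrakk>x \<in> carrier R; y \<in> carrier R\<rbrakk>
    \<Longrightarrow> \<alpha> (x \<otimes> \<alpha> y) \<otimes> \<alpha> y = \<alpha> (y \<otimes> \<alpha> x) \<otimes> \<alpha> x"

text \<open>The nullary operations impose no compatibility condition on a congruence.\<close>

definition is_congruence :: "('a, 'm) involutive_ring_scheme \<Rightarrow> ('a \<times> 'a) set \<Rightarrow> bool"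
  where "is_congruence R \<theta> \<longleftrightarrow>
    equiv (carrier R) \<theta> \<and>
    (\<forall>x x' y y'. (x, x') \<in> \<theta> \<longrightarrow> (y, y') \<in> \<theta> \<longrightarrow> (x \<oplus>\<^bsub>R\<^esub> y, x' \<oplus>\<^bsub>R\<^esub> y') \<in> \<theta>) \<and>
    (\<forall>x x' y y'. (x, x') \<in> \<theta> \<longrightarrow> (y, y') \<in> \<theta> \<longrightarrow> (x \<otimes>\<^bsub>R\<^esub> y, x' \<otimes>\<^bsub>R\<^esub> y') \<in> \<theta>) \<and>
    (\<forall>x x'. (x, x') \<in> \<theta> \<longrightarrow> (\<alpha>\<^bsub>R\<^esub> x, \<alpha>\<^bsub>R\<^esub> x') \<in> \<theta>)"

definition congruence_regular :: "('a, 'm) involutive_ring_scheme \<Rightarrow> bool"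
  where "congruence_regular R \<longleftrightarrow>
    (\<forall>\<theta> \<phi>. is_congruence R \<theta> \<longrightarrow> is_congruence R \<phi> \<longrightarrow>
      (\<forall>a \<in> carrier R. \<theta> `` {a} = \<phi> `` {a} \<longrightarrow> \<theta> = \<phi>))"

definition witness1 :: "('a, 'm) involutive_ring_scheme \<Rightarrow> 'a \<Rightarrow> 'a \<Rightarrow> 'a \<Rightarrow> 'a"
  where "witness1 R x y z =
    ((x \<otimes>\<^bsub>R\<^esub> \<alpha>\<^bsub>R\<^esub> y) \<oplus>\<^bsub>R\<^esub> (y \<otimes>\<^bsub>R\<^esub> \<alpha>\<^bsub>R\<^esub> x)) \<oplus>\<^bsub>R\<^esub> z"

definition witness2 :: "('a, 'm) involutive_ring_scheme \<Rightarrow> 'a \<Rightarrow> 'a \<Rightarrow> 'a \<Rightarrow> 'a"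
  where "witness2 R x y z =
    \<alpha>\<^bsub>R\<^esub> ((x \<otimes>\<^bsub>R\<^esub> \<alpha>\<^bsub>R\<^esub> y) \<oplus>\<^bsub>R\<^esub> (y \<otimes>\<^bsub>R\<^esub> \<alpha>\<^bsub>R\<^esub> x)) \<otimes>\<^bsub>R\<^esub> z"

end

theory Submission
  imports Defs
begin

text \<open>In a Lukasiewicz near semiring \<open>\<alpha> \<zero> = \<one>\<close> and \<open>x \<otimes> \<alpha> x = \<zero>\<close>, so the symmetric term
  \<open>s = x \<otimes> \<alpha> y \<oplus> y \<otimes> \<alpha> x\<close> vanishes for \<open>x = y\<close>. Conversely, suppose \<open>s \<oplus> z = z\<close> and
  \<open>\<alpha> s \<otimes> z = z\<close>. Then \<open>\<alpha> z \<preceq> \<alpha> s\<close> gives \<open>\<alpha> z \<otimes> s = \<zero>\<close>, and the Lukasiewicz identity for \<open>\<alpha> s\<close>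
  and \<open>\<alpha> z\<close> reads \<open>s = \<alpha> (\<alpha> z \<otimes> s) \<otimes> s = \<alpha> (\<alpha> s \<otimes> z) \<otimes> z = \<alpha> z \<otimes> z = \<zero>\<close>. Hence
  \<open>x \<otimes> \<alpha> y = y \<otimes> \<alpha> x = \<zero>\<close>, and the Lukasiewicz identity for \<open>x\<close> and \<open>y\<close> yields \<open>\<alpha> y = \<alpha> x\<close>.
  Carrying this out modulo an arbitrary congruence avoids quotient algebras; the trivial
  congruence gives the statement about witness terms.\<close>

lemma is_congruence_Id_on:
  assumes "lukasiewicz_near_semiring R"
  shows "is_congruence R (Id_on (carrier R))"
proof -
  interpret lukasiewicz_near_semiring R by fact
  have "equiv (carrier R) (Id_on (carrier R))"
    by (auto simp: equiv_def refl_on_def sym_def trans_def)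
  then show ?thesis
    by (auto simp: is_congruence_def m_closed invol_closed)
qed

context lukasiewicz_near_semiring
begin

declare m_closed [simp] one_closed [simp] r_one [simp] l_one [simp] r_null [simp] l_null [simp]
  add_idem [simp] invol_closed [simp] invol_invol [simp]

lemma le_zero_imp_eq: "\<lbrakk>x \<in> carrier R; x \<preceq> \<zero>\<rbrakk> \<Longrightarrow> x = \<zero>"
  by (simp add: induced_le_def)

lemma le_add1: "\<lbrakk>x \<in> carrier R; y \<in> carrier R\<rbrakk> \<Longrightarrow> x \<preceq> x \<oplus> y"
  by (simp add: induced_le_def a_assoc [symmetric])

lemma mult_right_mono:
  "\<lbrakk>x \<in> carrier R; y \<in> carrier R; z \<in> carrier R; x \<preceq> y\<rbrakk> \<Longrightarrow> x \<otimes> z \<preceq> y \<otimes> z"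
  by (simp add: induced_le_def l_distr [symmetric])

text \<open>As the additive unit, \<open>\<zero>\<close> is the least element, and the antitone
  involution sends it to the greatest.\<close>

lemma le_invol_zero:
  assumes "x \<in> carrier R"
  shows "x \<preceq> \<alpha> \<zero>"
  using invol_antimono [of \<zero> "\<alpha> x"] assms by (simp add: induced_le_def)

text \<open>The Lukasiewicz identity for \<open>\<zero>\<close> and \<open>\<one>\<close> collapses
  to \<open>\<alpha> \<zero> \<otimes> \<alpha> \<one> = \<zero>\<close>. Since
  \<open>\<one> \<preceq> \<alpha> \<zero>\<close>, this product bounds
  \<open>\<alpha> \<one>\<close> from above.\<close>

lemma invol_one: "\<alpha> \<one> = \<zero>"
proof -
  have "\<one> \<otimes> \<alpha> \<one> \<preceq> \<alpha> \<zero> \<otimes> \<alpha> \<one>"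
    by (intro mult_right_mono le_invol_zero) simp_all
  then show ?thesis
    using lukasiewicz [of \<zero> \<one>] by (simp add: le_zero_imp_eq)
qed

lemma invol_zero: "\<alpha> \<zero> = \<one>"
  by (metis invol_one invol_invol one_closed)

text \<open>In the Lukasiewicz identity for \<open>x\<close> and \<open>\<one>\<close>, the factor
  \<open>\<alpha> \<one> = \<zero>\<close> kills one side, and the other becomes
  \<open>x \<otimes> \<alpha> x\<close>.\<close>

lemma mult_invol_self: "x \<in> carrier R \<Longrightarrow> x \<otimes> \<alpha> x = \<zero>"
  using lukasiewicz [of x \<one>] by (simp add: invol_one)

lemma invol_mult_self: "x \<in> carrier R \<Longrightarrow> \<alpha> x \<otimes> x = \<zero>"
  using mult_invol_self [of "\<alpha> x"] by simp

text \<open>Right distributivity makes right multiplication monotone, so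
  \<open>\<alpha> (x \<oplus> y) \<preceq> \<alpha> x\<close> bounds the product by
  \<open>\<alpha> x \<otimes> x = \<zero>\<close>.\<close>

lemma invol_add_mult:
  assumes "x \<in> carrier R" "y \<in> carrier R"
  shows "\<alpha> (x \<oplus> y) \<otimes> x = \<zero>"
proof -
  have "\<alpha> (x \<oplus> y) \<otimes> x \<preceq> \<alpha> x \<otimes> x"
    using assms by (intro mult_right_mono invol_antimono le_add1) simp_all
  then show ?thesis
    using assms by (simp add: invol_mult_self le_zero_imp_eq)
qed

lemma witness_self:
  assumes "x \<in> carrier R" "z \<in> carrier R"
  shows "witness1 R x x z = z" "witness2 R x x z = z"
  using assms by (simp_all add: witness1_def witness2_def mult_invol_self invol_zero)

lemma witness_cong:
  assumes cong: "is_congruence R \<theta>"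
    and mem: "(x, y) \<in> \<theta>" "z \<in> carrier R"
  shows "(witness1 R x y z, z) \<in> \<theta>" "(witness2 R x y z, z) \<in> \<theta>"
proof -
  have equiv: "equiv (carrier R) \<theta>"
    and add: "\<And>u u' v v'. \<lbrakk>(u, u') \<in> \<theta>; (v, v') \<in> \<theta>\<rbrakk> \<Longrightarrow> (u \<oplus> v, u' \<oplus> v') \<in> \<theta>"
    and mult: "\<And>u u' v v'. \<lbrakk>(u, u') \<in> \<theta>; (v, v') \<in> \<theta>\<rbrakk> \<Longrightarrow> (u \<otimes> v, u' \<otimes> v') \<in> \<theta>"
    and invol: "\<And>u u'. (u, u') \<in> \<theta> \<Longrightarrow> (\<alpha> u, \<alpha> u') \<in> \<theta>"
    using cong unfolding is_congruence_def by blast+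
  have x: "x \<in> carrier R" and y: "y \<in> carrier R"
    using equiv_type [OF equiv] mem(1) by auto
  have refl: "\<And>u. u \<in> carrier R \<Longrightarrow> (u, u) \<in> \<theta>"
    using equiv by (meson equiv_def refl_onD)
  have "(witness1 R x y z, witness1 R y y z) \<in> \<theta>" "(witness2 R x y z, witness2 R y y z) \<in> \<theta>"
    unfolding witness1_def witness2_def using mem y by (intro add mult invol refl; simp)+
  then show "(witness1 R x y z, z) \<in> \<theta>" "(witness2 R x y z, z) \<in> \<theta>"
    using mem y by (simp_all add: witness_self)
qed

lemma cong_if_witness:
  assumes cong: "is_congruence R \<theta>"
    and x: "x \<in> carrier R" and y: "y \<in> carrier R" and z: "z \<in> carrier R"
    and w1: "(witness1 R x y z, z) \<in> \<theta>" and w2: "(witness2 R x y z, z) \<in> \<theta>"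
  shows "(x, y) \<in> \<theta>"
proof -
  have equiv: "equiv (carrier R) \<theta>"
    and add: "\<And>u u' v v'. \<lbrakk>(u, u') \<in> \<theta>; (v, v') \<in> \<theta>\<rbrakk> \<Longrightarrow> (u \<oplus> v, u' \<oplus> v') \<in> \<theta>"
    and mult: "\<And>u u' v v'. \<lbrakk>(u, u') \<in> \<theta>; (v, v') \<in> \<theta>\<rbrakk> \<Longrightarrow> (u \<otimes> v, u' \<otimes> v') \<in> \<theta>"
    and invol: "\<And>u u'. (u, u') \<in> \<theta> \<Longrightarrow> (\<alpha> u, \<alpha> u') \<in> \<theta>"
    using cong unfolding is_congruence_def by blast+
  have refl: "\<And>u. u \<in> carrier R \<Longrightarrow> (u, u) \<in> \<theta>"
    using equiv by (meson equiv_def refl_onD)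
  have sym: "\<And>u v. (u, v) \<in> \<theta> \<Longrightarrow> (v, u) \<in> \<theta>"
    using equiv by (meson equiv_def symD)
  have trans [trans]: "\<And>u v w. \<lbrakk>(u, v) \<in> \<theta>; (v, w) \<in> \<theta>\<rbrakk> \<Longrightarrow> (u, w) \<in> \<theta>"
    using equiv by (meson equiv_def transD)
  \<comment> \<open>Here \<open>\<alpha> u\<close> is congruent to
    \<open>\<alpha> \<zero> = \<one>\<close>.\<close>
  have invol_mult_cong: "(\<alpha> u \<otimes> v, v) \<in> \<theta>" if "(u, \<zero>) \<in> \<theta>" "v \<in> carrier R" for u v
    using mult [OF invol [OF that(1)] refl [OF that(2)]] that(2) by (simp add: invol_zero)
  \<comment> \<open>Adding \<open>u\<close> to both sides of the hypothesis leaves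
    \<open>u \<oplus> v\<close> unchanged by idempotence and turns \<open>\<zero>\<close> into
    \<open>u\<close>.\<close>
  have summand_cong_zero: "(u, \<zero>) \<in> \<theta>"
    if sum: "(u \<oplus> v, \<zero>) \<in> \<theta>" and u: "u \<in> carrier R" and v: "v \<in> carrier R" for u v
  proof -
    have "(u \<oplus> (u \<oplus> v), u \<oplus> \<zero>) \<in> \<theta>"
      by (intro add refl sum u)
    then have "(u \<oplus> v, u) \<in> \<theta>"
      using u v by (simp add: a_assoc [symmetric])
    from trans [OF sym [OF this] sum] show ?thesis .
  qed
  define s where "s = x \<otimes> \<alpha> y \<oplus> y \<otimes> \<alpha> x"
  have s: "s \<in> carrier R"
    using x y by (simp add: s_def)
  have s_add: "(s \<oplus> z, z) \<in> \<theta>" and s_mult: "(\<alpha> s \<otimes> z, z) \<in> \<theta>"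
    using w1 w2 by (simp_all add: witness1_def witness2_def s_def)
  \<comment> \<open>The relation \<open>s \<preceq> z\<close> holds only modulo
    \<open>\<theta>\<close>. Replacing \<open>z\<close> by the congruent \<open>s \<oplus> z\<close>
    gives an element that lies above \<open>s\<close> in \<open>R\<close> itself.\<close>
  have "(\<alpha> z \<otimes> s, \<alpha> (s \<oplus> z) \<otimes> s) \<in> \<theta>"
    by (intro mult invol sym [OF s_add] refl s)
  then have "(\<alpha> z \<otimes> s, \<zero>) \<in> \<theta>"
    using s z by (simp add: invol_add_mult)
  then have "(s, \<alpha> (\<alpha> z \<otimes> s) \<otimes> s) \<in> \<theta>"
    using s by (rule sym [OF invol_mult_cong])
  also have "\<alpha> (\<alpha> z \<otimes> s) \<otimes> s = \<alpha> (\<alpha> s \<otimes> z) \<otimes> z"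
    using lukasiewicz [of "\<alpha> z" "\<alpha> s"] s z by simp
  also have "(\<alpha> (\<alpha> s \<otimes> z) \<otimes> z, \<alpha> z \<otimes> z) \<in> \<theta>"
    by (intro mult invol s_mult refl z)
  finally have s_zero: "(s, \<zero>) \<in> \<theta>"
    using z by (simp add: invol_mult_self)
  have "(x \<otimes> \<alpha> y, \<zero>) \<in> \<theta>"
    by (rule summand_cong_zero [of _ "y \<otimes> \<alpha> x"]) (use s_zero x y in \<open>simp_all add: s_def\<close>)
  moreover have "(y \<otimes> \<alpha> x, \<zero>) \<in> \<theta>"
    by (rule summand_cong_zero [of _ "x \<otimes> \<alpha> y"])
      (use s_zero x y a_comm [of "x \<otimes> \<alpha> y" "y \<otimes> \<alpha> x"] in \<open>simp_all add: s_def\<close>)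
  ultimately have y_cong: "(\<alpha> (x \<otimes> \<alpha> y) \<otimes> \<alpha> y, \<alpha> y) \<in> \<theta>"
    and x_cong: "(\<alpha> (y \<otimes> \<alpha> x) \<otimes> \<alpha> x, \<alpha> x) \<in> \<theta>"
    using x y by (simp_all add: invol_mult_cong)
  have "(\<alpha> x, \<alpha> y) \<in> \<theta>"
    using trans [OF sym [OF x_cong]] y_cong lukasiewicz [OF x y] by simp
  from invol [OF this] show ?thesis
    using x y by simp
qed

lemma witness_iff:
  assumes "x \<in> carrier R" "y \<in> carrier R" "z \<in> carrier R"
  shows "witness1 R x y z = z \<and> witness2 R x y z = z \<longleftrightarrow> x = y"
proof
  assume "witness1 R x y z = z \<and> witness2 R x y z = z"
  then have "(x, y) \<in> Id_on (carrier R)"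
    using assms lukasiewicz_near_semiring_axioms
    by (intro cong_if_witness [of _ x y z] is_congruence_Id_on) auto
  then show "x = y"
    by auto
qed (use assms in \<open>simp add: witness_self\<close>)

text \<open>For a pair in \<open>\<theta>\<close>, both witness terms with third argument
  \<open>a\<close> fall into the \<open>\<theta>\<close>-class of \<open>a\<close>, hence into its
  \<open>\<phi>\<close>-class, and this forces the pair into \<open>\<phi>\<close>.\<close>

lemma congruence_subset_if_class_subset:
  assumes \<theta>: "is_congruence R \<theta>" and \<phi>: "is_congruence R \<phi>"
    and a: "a \<in> carrier R" and class_le: "\<theta> `` {a} \<subseteq> \<phi> `` {a}"
  shows "\<theta> \<subseteq> \<phi>"
proof clarify
  fix x y
  assume xy: "(x, y) \<in> \<theta>"
  have equiv: "equiv (carrier R) \<theta>" "equiv (carrier R) \<phi>"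
    using \<theta> \<phi> by (simp_all add: is_congruence_def)
  have *: "(u, a) \<in> \<phi>" if "(u, a) \<in> \<theta>" for u
    using that class_le equiv by (meson Image_singleton_iff equiv_def subsetD symD)
  have "x \<in> carrier R" "y \<in> carrier R"
    using equiv_type [OF equiv(1)] xy by auto
  then show "(x, y) \<in> \<phi>"
    using cong_if_witness [OF \<phi>] a * witness_cong [OF \<theta> xy a] by blast
qed

lemma congruence_regular: "congruence_regular R"
  unfolding congruence_regular_def
  by (intro allI impI ballI equalityI; rule congruence_subset_if_class_subset; assumption?; simp)

end

theorem theorem7:
  fixes R :: "('a, 'm) involutive_ring_scheme"
  assumes "lukasiewicz_near_semiring R"
  shows "(\<forall>x \<in> carrier R. \<forall>y \<in> carrier R. \<forall>z \<in> carrier R.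
            witness1 R x y z = z \<and> witness2 R x y z = z \<longleftrightarrow> x = y)
         \<and> congruence_regular R"
proof -
  interpret lukasiewicz_near_semiring R by fact
  show ?thesis
    using witness_iff congruence_regular by blast
qed

end
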